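(* Let $K,L,Q\in\mathcal{S}_{c+}^n$, let $q\ne0$ be real, let $\varphi:(0,\infty)\to(0,\infty)$ be continuous, and let $\varphi_q(t)=\varphi(t^{1/q})$ for $t\in(0,\infty)$. If $\varphi_q$ is convex, then $$\widetilde{V}_{q,\varphi}(K,L,Q)\ge\widetilde{V}_q(K,Q)\,\varphi\!\left(\left(\frac{\widetilde{V}_q(L,Q)}{\widetilde{V}_q(K,Q)}\right)^{1/q}\right).$$ The reverse inequality $$\widetilde{V}_{q,\varphi}(K,L,Q)\le\widetilde{V}_q(K,Q)\,\varphi\!\left(\left(\frac{\widetilde{V}_q(L,Q)}{\widetilde{V}_q(K,Q)}\right)^{1/q}\right)$$ holds if $\varphi_q$ is concave. If $\varphi_q$ is strictly convex or strictly concave, respectively, equality $$\widetilde{V}_{q,\varphi}(K,L,Q)=\widetilde{V}_q(K,Q)\,\varphi\!\left(\left(\frac{\widetilde{V}_q(L,Q)}{\widetilde{V}_q(K,Q)}\right)^{1/q}\right)$$ holds if and only if $K$ and $L$ are dilatates of each other.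
   Context: $\mathcal{S}_{c+}^n$ is the class of star bodies in $\mathbb{R}^n$: compact sets $L$ that are star-shaped about the origin and whose radial function $\rho_L(u)=\sup\{\lambda>0:\lambda u\in L\}$, $u\in S^{n-1}$, is positive and continuous on $S^{n-1}$ (so a star body is determined by its radial function). Two star bodies are dilatates of each other if one is $c$ times the other for some $c>0$. With $du=d\mathcal{H}^{n-1}(u)$ on $S^{n-1}$, define $$\widetilde{V}_q(K,Q)=\frac1n\int_{S^{n-1}}\rho_K(u)^q\rho_Q(u)^{n-q}\,du,$$ $$\widetilde{V}_{q,\varphi}(K,L,Q)=\frac1n\int_{S^{n-1}}\varphi\!\left(\frac{\rho_L(u)}{\rho_K(u)}\right)\rho_K(u)^q\rho_Q(u)^{n-q}\,du.$$ *)

theory Defs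
  imports "HOL-Analysis.Analysis"
begin

(* The family U is a countable cover of A by sets of diameter at most d; finite covers are included
   by taking almost all U i empty.  Boundedness is demanded separately because diameter carries no
   information for unbounded sets.  The empty set contributes 0 also for k = 0, where 0 ^ 0 = 1 is
   the contribution of a singleton, so that the case k = 0 gives counting measure.  The factor
   unit_ball_vol k / 2 ^ k is the normalization for which k-dimensional Hausdorff measure
   coincides with k-dimensional Lebesgue measure in k-dimensional Euclidean space. *)
definition hausdorff_premeasure :: "nat \<Rightarrow> real \<Rightarrow> 'a::metric_space set \<Rightarrow> ennreal" where
  "hausdorff_premeasure k d A =
     (INF U \<in> {U :: nat \<Rightarrow> 'a set. A \<subseteq> (\<Union>i. U i) \<and> (\<forall>i. bounded (U i) \<and> diameter (U i) \<le> d)}.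
        \<Sum>i. if U i = {} then 0
            else ennreal (unit_ball_vol (real k) / 2 ^ k * diameter (U i) ^ k))"

definition hausdorff_outer_measure :: "nat \<Rightarrow> 'a::metric_space set \<Rightarrow> ennreal" where
  "hausdorff_outer_measure k A = (SUP d \<in> {0<..}. hausdorff_premeasure k d A)"

(* The restriction to the Borel sets; it is countably additive there because
   hausdorff_outer_measure k is a metric outer measure. *)
definition hausdorff_measure :: "nat \<Rightarrow> 'a::metric_space measure" where
  "hausdorff_measure k = measure_of UNIV (sets borel) (hausdorff_outer_measure k)"

(* Inserting 0 fixes the convention that the supremum of the empty set is 0: the real Sup {} is an
   unspecified number. *)
definition radial_function :: "'a::euclidean_space set \<Rightarrow> 'a \<Rightarrow> real" where
  "radial_function L u = Sup (insert 0 {r. 0 < r \<and> r *\<^sub>R u \<in> L})"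

definition star_body :: "'a::euclidean_space set \<Rightarrow> bool" where
  "star_body L \<longleftrightarrow>
     compact L \<and> 0 \<in> L \<and> (\<forall>x\<in>L. closed_segment 0 x \<subseteq> L) \<and>
     (\<forall>u\<in>sphere 0 1. 0 < radial_function L u) \<and>
     continuous_on (sphere 0 1) (radial_function L)"

definition dilatates :: "'a::euclidean_space set \<Rightarrow> 'a set \<Rightarrow> bool" where
  "dilatates K L \<longleftrightarrow> (\<exists>c>0. K = (\<lambda>x. c *\<^sub>R x) ` L)"

definition dual_mixed_volume :: "real \<Rightarrow> 'a::euclidean_space set \<Rightarrow> 'a set \<Rightarrow> real" where
  "dual_mixed_volume q K Q =
     1 / real DIM('a) *
     (LINT u : sphere 0 1 | hausdorff_measure (DIM('a) - 1).
        radial_function K u powr q * radial_function Q u powr (real DIM('a) - q))"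

definition orlicz_dual_mixed_volume ::
    "real \<Rightarrow> (real \<Rightarrow> real) \<Rightarrow> 'a::euclidean_space set \<Rightarrow> 'a set \<Rightarrow> 'a set \<Rightarrow> real" where
  "orlicz_dual_mixed_volume q \<phi> K L Q =
     1 / real DIM('a) *
     (LINT u : sphere 0 1 | hausdorff_measure (DIM('a) - 1).
        \<phi> (radial_function L u / radial_function K u) *
        radial_function K u powr q * radial_function Q u powr (real DIM('a) - q))"

definition strictly_convex_on :: "'a::real_vector set \<Rightarrow> ('a \<Rightarrow> real) \<Rightarrow> bool" where
  "strictly_convex_on S f \<longleftrightarrow> convex S \<and>
     (\<forall>x\<in>S. \<forall>y\<in>S. \<forall>u>0. \<forall>v>0. x \<noteq> y \<longrightarrow> u + v = 1 \<longrightarrow>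
        f (u *\<^sub>R x + v *\<^sub>R y) < u * f x + v * f y)"

definition strictly_concave_on :: "'a::real_vector set \<Rightarrow> ('a \<Rightarrow> real) \<Rightarrow> bool" where
  "strictly_concave_on S f \<longleftrightarrow> strictly_convex_on S (\<lambda>x. - f x)"

end

theory Submission
  imports Defs
begin

text \<open>
  Put \<open>w = \<rho>\<^sub>K\<^sup>q \<rho>\<^sub>Q\<^bsup>n-q\<^esup>\<close> and \<open>X = (\<rho>\<^sub>L / \<rho>\<^sub>K)\<^sup>q\<close> on the unit sphere.  Up to the factor \<open>1/n\<close>,
  the three dual mixed volumes are \<open>\<integral> w\<close>, \<open>\<integral> X w\<close> and \<open>\<integral> \<phi>q(X) w\<close>, so with the weighted mean
  \<open>m = \<integral> X w / \<integral> w\<close> the inequality reads \<open>\<phi>q(m) \<integral> w \<le> \<integral> \<phi>q(X) w\<close>: it is Jensen's inequality for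
  \<open>\<phi>q\<close> and the probability density \<open>w / \<integral> w\<close> (lemma \<open>sphere_jensen\<close>).  It follows by integrating
  the gap between \<open>\<phi>q\<close> and a supporting line at \<open>m\<close>.  The concave case is the convex case for
  \<open>- \<phi>q\<close>.

  If \<open>\<phi>q\<close> is strictly convex, the gap vanishes only at \<open>m\<close>.  In the equality case the integrand is
  continuous and nonnegative with integral zero, hence zero everywhere, so that \<open>X\<close> is constant.
  This says that \<open>\<rho>\<^sub>L / \<rho>\<^sub>K\<close> is constant, that is, \<open>K\<close> and \<open>L\<close> are dilatates
  (lemma \<open>dilatates_iff_radial_function\<close>).

  Most of the work lies in three facts about the Hausdorff measure on the sphere that this
  argument uses.

  \<^item> It is a measure: \<open>hausdorff_measure\<close> is built from an outer measure, and its values agree with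
    that outer measure on Borel sets only because the latter is a metric outer measure, for which
    Caratheodory's criterion makes all closed sets measurable.

  \<^item> The sphere has finite measure, so that continuous functions are integrable.  A maximal
    \<open>r\<close>-separated subset of the sphere has at most \<open>C r\<^bsup>1-n\<^esup>\<close> points, since the balls of radius
    \<open>r/2\<close> about them are disjoint and lie in an annulus of thickness \<open>r\<close>.

  \<^item> Nonempty relatively open subsets of the sphere have positive measure.  The cone with apex 0 over
    a piece of the sphere of diameter \<open>d\<close> has Lebesgue measure at most \<open>C d\<^bsup>n-1\<^esup>\<close>, so the gauge
    sum of any cover bounds, up to a constant, the volume of the cone over the covered set, and
    the cone over a relatively open set contains a ball.
\<close>


section \<open>Metric outer measures\<close>

definition metric_outer_measure :: "('a::metric_space set \<Rightarrow> ennreal) \<Rightarrow> bool" where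
  "metric_outer_measure f \<longleftrightarrow> outer_measure_space UNIV f \<and>
     (\<forall>A B. \<forall>e>0. (\<forall>x\<in>A. \<forall>y\<in>B. e \<le> dist x y) \<longrightarrow> f A + f B \<le> f (A \<union> B))"

lemma outer_measure_space_Un_le:
  assumes "outer_measure_space UNIV f"
  shows "f (A \<union> B) \<le> f A + f B"
proof -
  interpret sigma_algebra UNIV "UNIV :: 'a set set"
    using sigma_algebra_Pow[of UNIV] by simp
  have "subadditive UNIV f"
    using assms countably_subadditive_subadditive[of f]
    by (simp add: outer_measure_space_def)
  then have "f (A \<union> (B - A)) \<le> f A + f (B - A)"
    by (rule subadditiveD) auto
  also have "\<dots> \<le> f A + f B"
    using assms by (auto simp: outer_measure_space_def increasing_def intro!: add_left_mono)
  finally show ?thesis by simp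
qed

lemma outer_measure_space_UN_le:
  assumes "outer_measure_space UNIV f"
  shows "f (\<Union>i. A i) \<le> (\<Sum>i. f (A i :: 'a set))"
proof -
  have "f (\<Union>i. A i) = f (\<Union>i. disjointed A i)"
    by (simp add: UN_disjointed_eq)
  also have "\<dots> \<le> (\<Sum>i. f (disjointed A i))"
    using assms disjoint_family_disjointed[of A]
    by (auto simp: outer_measure_space_def countably_subadditive_def)
  also have "\<dots> \<le> (\<Sum>i. f (A i))"
    using assms disjointed_subset[of A]
    by (intro suminf_le summableI) (auto simp: outer_measure_space_def increasing_def)
  finally show ?thesis .
qed

text \<open>The set \<open>A - F\<close> is exhausted by the sets \<open>B n\<close> of points at distance at least \<open>1/(n+1)\<close>
  from \<open>F\<close>.  No continuity from below is available for an outer measure, so the remainder has to be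
  controlled by the layers \<open>R n = B (n+2) - B (n+1)\<close>.  Each layer is separated from \<open>B n\<close>, and so
  \<open>f (R n) \<le> f (B (n+2)) - f (B n)\<close>; these bounds telescope, which makes \<open>\<Sum>n. f (R n)\<close> finite and
  its tails negligible.\<close>
lemma metric_outer_measure_exhaustion:
  fixes f :: "'a::metric_space set \<Rightarrow> ennreal"
  assumes f: "metric_outer_measure f" and F: "closed F" "F \<noteq> {}" and fin: "f A < top"
  defines "B \<equiv> \<lambda>n. {x \<in> A. inverse (real (Suc n)) \<le> infdist x F}"
  shows "f (A - F) \<le> (SUP n. f (B n))"
proof -
  have oms: "outer_measure_space UNIV f"
    and sep: "\<And>A B e. e > 0 \<Longrightarrow> (\<And>x y. x \<in> A \<Longrightarrow> y \<in> B \<Longrightarrow> e \<le> dist x y) \<Longrightarrow> f A + f B \<le> f (A \<union> B)"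
    using f unfolding metric_outer_measure_def by blast+
  have mono: "A \<subseteq> B \<Longrightarrow> f A \<le> f B" for A B
    using oms by (auto simp: outer_measure_space_def increasing_def)
  have B_mono: "B m \<subseteq> B n" if "m \<le> n" for m n
    using that by (auto simp: B_def intro: order_trans[rotated] le_imp_inverse_le)
  define R where "R = (\<lambda>n. B (Suc (Suc n)) - B (Suc n))"
  have step: "f (B n) + f (R n) \<le> f (B (Suc (Suc n)))" for n
  proof -
    let ?e = "inverse (real (Suc n)) - inverse (real (Suc (Suc n)))"
    have "f (B n) + f (R n) \<le> f (B n \<union> R n)"
    proof (rule sep[of ?e])
      show "?e > 0" by (simp add: less_imp_inverse_less)
      fix x y assume "x \<in> B n" "y \<in> R n"
      then have "inverse (real (Suc n)) \<le> infdist x F" "infdist y F < inverse (real (Suc (Suc n)))"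
        by (auto simp: B_def R_def)
      with infdist_triangle[of x F y] show "?e \<le> dist x y" by linarith
    qed
    also have "\<dots> \<le> f (B (Suc (Suc n)))"
      using B_mono[of n "Suc (Suc n)"] by (intro mono) (auto simp: R_def)
    finally show ?thesis .
  qed
  \<comment> \<open>The bounds telescope over indices of equal parity, hence two summands on the right.\<close>
  have "(\<Sum>n<N. f (R n)) \<le> f (B N) + f (B (Suc N))" for N
  proof (induction N)
    case (Suc N)
    have "(\<Sum>n<Suc N. f (R n)) \<le> f (B (Suc N)) + (f (B N) + f (R N))"
      using add_right_mono[OF Suc, of "f (R N)"] by (simp add: ac_simps)
    also have "\<dots> \<le> f (B (Suc N)) + f (B (Suc (Suc N)))"
      by (intro add_left_mono step)
    finally show ?case .
  qed simp
  also have "f (B N) + f (B (Suc N)) \<le> f A + f A" for N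
    by (intro add_mono mono) (auto simp: B_def)
  finally have "(\<Sum>n. f (R n)) \<le> f A + f A"
    by (intro suminf_le_const summableI) auto
  with fin have sum_fin: "(\<Sum>n. f (R n)) \<noteq> top"
    by (metis ennreal_add_eq_top not_less top.extremum_uniqueI less_irrefl)
  have cover: "A - F \<subseteq> B (Suc n) \<union> (\<Union>i. R (i + n))" for n
  proof
    fix x assume x: "x \<in> A - F"
    with F have "infdist x F > 0"
      using in_closed_iff_infdist_zero infdist_nonneg[of x F] by (metis DiffD2 order_le_less)
    then obtain m where m: "inverse (real (Suc m)) < infdist x F"
      using reals_Archimedean by blast
    with x have xB: "\<exists>m. x \<in> B m" by (auto simp: B_def intro!: exI[of _ m])
    define k where "k = (LEAST m. x \<in> B m)"
    have k: "x \<in> B k" "\<And>j. j < k \<Longrightarrow> x \<notin> B j"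
      using LeastI_ex[OF xB] not_less_Least unfolding k_def by blast+
    show "x \<in> B (Suc n) \<union> (\<Union>i. R (i + n))"
    proof (cases "k \<le> Suc n")
      case True
      with k(1) B_mono show ?thesis by blast
    next
      case False
      then have "k = Suc (Suc ((k - n - 2) + n))" by simp
      with k have "x \<in> R ((k - n - 2) + n)" unfolding R_def by (metis DiffI lessI)
      then show ?thesis by blast
    qed
  qed
  let ?S = "SUP n. f (B n)"
  have le: "f (A - F) \<le> ?S + (\<Sum>i. f (R (i + n)))" for n
  proof -
    have "f (A - F) \<le> f (B (Suc n)) + f (\<Union>i. R (i + n))"
      using mono[OF cover] outer_measure_space_Un_le[OF oms] order_trans by blast
    also have "\<dots> \<le> ?S + (\<Sum>i. f (R (i + n)))"
      by (intro add_mono SUP_upper outer_measure_space_UN_le[OF oms]) auto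
    finally show ?thesis .
  qed
  \<comment> \<open>Instead of letting the tails tend to 0, add the whole series to both sides and cancel it at
    the end; this is where its finiteness enters.\<close>
  let ?T = "\<Sum>n. f (R n)"
  have "?T + f (A - F) \<le> ?T + ?S"
  proof (rule ennreal_suminf_bound_add)
    fix n
    have "(\<Sum>i<n. f (R i)) + f (A - F) \<le> (\<Sum>i<n. f (R i)) + (?S + (\<Sum>i. f (R (i + n))))"
      by (intro add_left_mono le)
    also have "\<dots> = ?T + ?S"
      using suminf_offset[of "\<lambda>i. f (R i)" n] by (simp add: ac_simps summableI)
    finally show "(\<Sum>i<n. f (R i)) + f (A - F) \<le> ?T + ?S" .
  qed
  then show ?thesis
    using sum_fin by (simp add: ennreal_add_left_cancel_le)
qed

text \<open>Caratheodory's criterion.  A closed set \<open>F\<close> splits every \<open>A\<close> additively, because \<open>A \<inter> F\<close> is separated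
  from the points of \<open>A\<close> at distance at least \<open>1/(n+1)\<close> from \<open>F\<close>, and these exhaust \<open>A - F\<close>; the sets with this splitting property form a
  sigma-algebra.\<close>
theorem metric_outer_measure_borel:
  fixes f :: "'a::metric_space set \<Rightarrow> ennreal"
  assumes f: "metric_outer_measure f"
  shows "sets borel \<subseteq> lambda_system UNIV UNIV f"
proof -
  interpret sigma_algebra UNIV "UNIV :: 'a set set"
    using sigma_algebra_Pow[of UNIV] by simp
  have oms: "outer_measure_space UNIV f"
    and sep: "\<And>A B e. e > 0 \<Longrightarrow> (\<And>x y. x \<in> A \<Longrightarrow> y \<in> B \<Longrightarrow> e \<le> dist x y) \<Longrightarrow> f A + f B \<le> f (A \<union> B)"
    using f unfolding metric_outer_measure_def by blast+
  have mono: "A \<subseteq> B \<Longrightarrow> f A \<le> f B" for A B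
    using oms by (auto simp: outer_measure_space_def increasing_def)
  have "F \<in> lambda_system UNIV UNIV f" if "closed F" for F
    unfolding lambda_system_eq
  proof (clarsimp, rule antisym)
    fix A
    have "A = (A \<inter> F) \<union> (A - F)" by blast
    then show "f A \<le> f (A \<inter> F) + f (A - F)"
      using outer_measure_space_Un_le[OF oms] by metis
    show "f (A \<inter> F) + f (A - F) \<le> f A"
    proof (cases "F = {} \<or> f A = top")
      case True
      then show ?thesis using oms by (auto simp: outer_measure_space_def positive_def)
    next
      case False
      let ?B = "\<lambda>n. {x \<in> A. inverse (real (Suc n)) \<le> infdist x F}"
      have "f (A \<inter> F) + f (A - F) \<le> f (A \<inter> F) + (SUP n. f (?B n))"
        using False \<open>closed F\<close> by (intro add_left_mono metric_outer_measure_exhaustion f) (auto simp: less_top)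
      also have "\<dots> = (SUP n. f (A \<inter> F) + f (?B n))"
        by (rule ennreal_SUP_add_right) simp
      also have "\<dots> \<le> f A"
      proof (rule SUP_least)
        fix n
        have "f (A \<inter> F) + f (?B n) \<le> f (A \<inter> F \<union> ?B n)"
        proof (rule sep[of "inverse (real (Suc n))"])
          fix x y assume "x \<in> A \<inter> F" "y \<in> ?B n"
          then show "inverse (real (Suc n)) \<le> dist x y"
            using infdist_le[of x F y] by (auto simp: dist_commute)
        qed simp
        also have "\<dots> \<le> f A" by (rule mono) auto
        finally show "f (A \<inter> F) + f (?B n) \<le> f A" .
      qed
      finally show ?thesis .
    qed
  qed
  moreover have "sigma_algebra UNIV (lambda_system UNIV UNIV f)"
    using caratheodory_lemma[OF oms] by (simp add: measure_space_def)
  ultimately have "sigma_sets UNIV (Collect closed) \<subseteq> lambda_system UNIV UNIV f"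
    by (intro sigma_algebra.sigma_sets_subset) auto
  then show ?thesis
    by (simp add: borel_eq_closed)
qed

section \<open>Hausdorff outer measure and Hausdorff measure\<close>

definition hausdorff_gauge :: "nat \<Rightarrow> 'a::metric_space set \<Rightarrow> ennreal" where
  "hausdorff_gauge k U = (if U = {} then 0 else ennreal (unit_ball_vol (real k) / 2 ^ k * diameter U ^ k))"

lemma hausdorff_gauge_empty [simp]: "hausdorff_gauge k {} = 0"
  by (simp add: hausdorff_gauge_def)

lemma hausdorff_premeasure_eq_INF:
  "hausdorff_premeasure k d A =
     (INF U \<in> {U. A \<subseteq> (\<Union>i. U i) \<and> (\<forall>i. bounded (U i) \<and> diameter (U i) \<le> d)}. \<Sum>i. hausdorff_gauge k (U i))"
  by (simp add: hausdorff_premeasure_def hausdorff_gauge_def)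

lemma hausdorff_premeasure_le:
  assumes "A \<subseteq> (\<Union>i. U i)" and "\<And>i. bounded (U i)" and "\<And>i. diameter (U i) \<le> d"
  shows "hausdorff_premeasure k d A \<le> (\<Sum>i. hausdorff_gauge k (U i))"
  unfolding hausdorff_premeasure_eq_INF using assms by (intro INF_lower) auto

lemma hausdorff_premeasure_mono: "A \<subseteq> B \<Longrightarrow> hausdorff_premeasure k d A \<le> hausdorff_premeasure k d B"
  unfolding hausdorff_premeasure_eq_INF by (intro INF_superset_mono) auto

lemma hausdorff_premeasure_antimono: "d \<le> e \<Longrightarrow> hausdorff_premeasure k e A \<le> hausdorff_premeasure k d A"
  unfolding hausdorff_premeasure_eq_INF by (intro INF_superset_mono) (auto intro: order_trans)

lemma hausdorff_premeasure_le_outer: "d > 0 \<Longrightarrow> hausdorff_premeasure k d A \<le> hausdorff_outer_measure k A"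
  unfolding hausdorff_outer_measure_def by (intro SUP_upper) auto

lemma hausdorff_premeasure_UN_le:
  fixes A :: "nat \<Rightarrow> 'a::metric_space set"
  shows "hausdorff_premeasure k d (\<Union>i. A i) \<le> (\<Sum>i. hausdorff_premeasure k d (A i))"
proof (rule ennreal_le_epsilon)
  fix e :: real assume e: "0 < e" and fin: "(\<Sum>n. hausdorff_premeasure k d (A n)) < top"
  let ?O = "hausdorff_premeasure k d :: 'a set \<Rightarrow> ennreal"
  have *: "?O (A n) < ?O (A n) + e * (1/2)^Suc n" for n
    using e fin by (auto simp add: less_top dest!: ennreal_suminf_lessD)
  have "\<exists>U. A n \<subseteq> (\<Union>i. U i) \<and> (\<forall>i. bounded (U i) \<and> diameter (U i) \<le> d) \<and>
      (\<Sum>i. hausdorff_gauge k (U i)) \<le> ?O (A n) + e * (1/2)^Suc n" for n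
    using *[of n] unfolding hausdorff_premeasure_eq_INF[of k d "A n"] INF_less_iff by (auto intro: less_imp_le)
  then have "\<forall>n. \<exists>U. A n \<subseteq> (\<Union>i. U i) \<and> (\<forall>i. bounded (U i) \<and> diameter (U i) \<le> d) \<and>
      (\<Sum>i. hausdorff_gauge k (U i)) \<le> ?O (A n) + e * (1/2)^Suc n" ..
  from choice[OF this] obtain U where U: "\<And>n. A n \<subseteq> (\<Union>i. U n i)" "\<And>n i. bounded (U n i)" "\<And>n i. diameter (U n i) \<le> d"
      "\<And>n. (\<Sum>i. hausdorff_gauge k (U n i)) \<le> ?O (A n) + e * (1/2)^Suc n"
    by blast
  define C where "C = case_prod U o prod_decode"
  have "(\<Union>i. A i) \<subseteq> (\<Union>i. C i)"
    using U(1) by (auto simp add: C_def subset_eq) (metis prod.case prod_encode_inverse)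
  then have "?O (\<Union>i. A i) \<le> (\<Sum>i. hausdorff_gauge k (C i))"
    using U(2,3) by (intro hausdorff_premeasure_le) (auto simp: C_def split_def)
  also have "\<dots> = (\<Sum>n. \<Sum>i. hausdorff_gauge k (U n i))"
    using suminf_ennreal_2dimen[of _ "\<lambda>(n,i). hausdorff_gauge k (U n i)"]
    by (simp add: C_def comp_def split_def)
  also have "\<dots> \<le> (\<Sum>n. ?O (A n) + ennreal (e * (1/2) ^ Suc n))"
    by (intro suminf_le summableI U(4))
  also have "\<dots> = (\<Sum>n. ?O (A n)) + (\<Sum>n. ennreal (e * (1/2) ^ Suc n))"
    by (intro suminf_add[symmetric] summableI)
  also have "(\<Sum>n. ennreal (e * (1/2) ^ Suc n)) = ennreal e"
    using sums_mult[OF power_half_series, of e] e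
    by (intro suminf_ennreal_eq) auto
  finally show "?O (\<Union>i. A i) \<le> (\<Sum>n. ?O (A n)) + ennreal e" .
qed

text \<open>A set of diameter at most \<open>d\<close> cannot meet both \<open>A\<close> and \<open>B\<close>, so a cover of the union splits into
  a cover of \<open>A\<close> and a cover of \<open>B\<close>.\<close>
lemma hausdorff_premeasure_separated:
  fixes A :: "'a::metric_space set"
  assumes sep: "\<And>x y. x \<in> A \<Longrightarrow> y \<in> B \<Longrightarrow> d < dist x y"
  shows "hausdorff_premeasure k d A + hausdorff_premeasure k d B \<le> hausdorff_premeasure k d (A \<union> B)"
  unfolding hausdorff_premeasure_eq_INF[of k d "A \<union> B"]
proof (rule INF_greatest)
  fix U :: "nat \<Rightarrow> 'a set" assume "U \<in> {U. A \<union> B \<subseteq> (\<Union>i. U i) \<and> (\<forall>i. bounded (U i) \<and> diameter (U i) \<le> d)}"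
  then have U: "A \<union> B \<subseteq> (\<Union>i. U i)" "\<forall>i. bounded (U i) \<and> diameter (U i) \<le> d" by blast+
  define V where "V = (\<lambda>i. if U i \<inter> A = {} then {} else U i)"
  define W where "W = (\<lambda>i. if U i \<inter> A = {} then U i else {})"
  have "A \<subseteq> (\<Union>i. V i)" using U(1) unfolding V_def by fastforce
  moreover have "B \<subseteq> (\<Union>i. W i)"
  proof
    fix y assume y: "y \<in> B"
    with U(1) obtain i where i: "y \<in> U i" by auto
    have "U i \<inter> A = {}"
    proof (rule ccontr)
      assume "U i \<inter> A \<noteq> {}"
      then obtain x where "x \<in> U i" "x \<in> A" by auto
      with diameter_bounded_bound[of "U i" x y] U(2) i sep[of x y] y show False
        by (meson not_le order_trans)
    qed
    with i show "y \<in> (\<Union>i. W i)" unfolding W_def by auto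
  qed
  moreover have "0 \<le> d"
    using U(2) diameter_ge_0 order_trans by blast
  ultimately have "hausdorff_premeasure k d A + hausdorff_premeasure k d B
      \<le> (\<Sum>i. hausdorff_gauge k (V i)) + (\<Sum>i. hausdorff_gauge k (W i))"
    using U(2) by (intro add_mono hausdorff_premeasure_le) (auto simp: V_def W_def)
  also have "\<dots> = (\<Sum>i. hausdorff_gauge k (V i) + hausdorff_gauge k (W i))"
    by (intro suminf_add summableI)
  also have "(\<lambda>i. hausdorff_gauge k (V i) + hausdorff_gauge k (W i)) = (\<lambda>i. hausdorff_gauge k (U i))"
    by (auto simp: V_def W_def)
  finally show "hausdorff_premeasure k d A + hausdorff_premeasure k d B \<le> (\<Sum>i. hausdorff_gauge k (U i))" .
qed

lemma metric_outer_measure_hausdorff: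
  "metric_outer_measure (hausdorff_outer_measure k :: 'a::metric_space set \<Rightarrow> ennreal)"
  unfolding metric_outer_measure_def
proof (intro conjI allI impI)
  let ?H = "hausdorff_outer_measure k :: 'a set \<Rightarrow> ennreal"
  have "hausdorff_premeasure k d ({} :: 'a set) = 0" if "d > 0" for d
    using hausdorff_premeasure_le[of "{}" "\<lambda>_. {}" d k] that by simp
  then have "positive UNIV ?H"
    by (simp add: positive_def hausdorff_outer_measure_def)
  moreover have "increasing UNIV ?H"
    unfolding increasing_def hausdorff_outer_measure_def
    by (auto intro!: SUP_mono' hausdorff_premeasure_mono)
  moreover have "?H (\<Union>i. A i) \<le> (\<Sum>i. ?H (A i))" for A :: "nat \<Rightarrow> 'a set"
    unfolding hausdorff_outer_measure_def[of k "\<Union>i. A i"]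
  proof (rule SUP_least)
    fix d :: real assume "d \<in> {0<..}"
    then have "(\<Sum>i. hausdorff_premeasure k d (A i)) \<le> (\<Sum>i. ?H (A i))"
      by (intro suminf_le summableI hausdorff_premeasure_le_outer) auto
    with hausdorff_premeasure_UN_le[of k d A]
    show "hausdorff_premeasure k d (\<Union>i. A i) \<le> (\<Sum>i. ?H (A i))" by (rule order_trans)
  qed
  ultimately show "outer_measure_space UNIV ?H"
    by (simp add: outer_measure_space_def countably_subadditive_def)
next
  fix A B :: "'a set" and e :: real
  assume e: "e > 0" and sep: "\<forall>x\<in>A. \<forall>y\<in>B. e \<le> dist x y"
  let ?P = "hausdorff_premeasure k :: real \<Rightarrow> 'a set \<Rightarrow> ennreal"
  have *: "?P d A + ?P d' B \<le> hausdorff_outer_measure k (A \<union> B)" if "d > 0" "d' > 0" for d d'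
  proof -
    define r where "r = min (e / 2) (min d d')"
    have "?P d A + ?P d' B \<le> ?P r A + ?P r B"
      by (intro add_mono hausdorff_premeasure_antimono) (auto simp: r_def)
    also have "\<dots> \<le> ?P r (A \<union> B)"
      using e sep by (intro hausdorff_premeasure_separated) (force simp: r_def)
    also have "\<dots> \<le> hausdorff_outer_measure k (A \<union> B)"
      using e that by (intro hausdorff_premeasure_le_outer) (auto simp: r_def)
    finally show ?thesis .
  qed
  have "hausdorff_outer_measure k A + hausdorff_outer_measure k B =
      (SUP d\<in>{0<..}. SUP d'\<in>{0<..}. ?P d A + ?P d' B)"
    unfolding hausdorff_outer_measure_def
    by (subst ennreal_SUP_add_left[symmetric]) (auto simp: ennreal_SUP_add_right)
  also have "\<dots> \<le> hausdorff_outer_measure k (A \<union> B)"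
    by (intro SUP_least *) auto
  finally show "hausdorff_outer_measure k A + hausdorff_outer_measure k B \<le> hausdorff_outer_measure k (A \<union> B)" .
qed

lemma sets_hausdorff_measure [simp, measurable_cong]: "sets (hausdorff_measure k) = sets borel"
  by (simp add: hausdorff_measure_def sets.sigma_sets_eq[of borel, simplified])

lemma space_hausdorff_measure [simp]: "space (hausdorff_measure k) = UNIV"
  by (simp add: hausdorff_measure_def)

text \<open>By its definition as \<open>measure_of\<close>, \<open>hausdorff_measure k\<close> would be the zero measure if the
  outer measure were not countably additive on the Borel sets.\<close>
theorem emeasure_hausdorff_measure:
  fixes A :: "'a::metric_space set"
  assumes "A \<in> sets borel"
  shows "emeasure (hausdorff_measure k) A = hausdorff_outer_measure k A"
proof -
  interpret sigma_algebra UNIV "UNIV :: 'a set set"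
    using sigma_algebra_Pow[of UNIV] by simp
  let ?H = "hausdorff_outer_measure k :: 'a set \<Rightarrow> ennreal"
  have oms: "outer_measure_space UNIV ?H"
    using metric_outer_measure_hausdorff[of k, where 'a='a] by (simp add: metric_outer_measure_def)
  have ca: "countably_additive (lambda_system UNIV UNIV ?H) ?H"
    using caratheodory_lemma[OF oms] by (simp add: measure_space_def)
  have borel: "sets borel \<subseteq> lambda_system UNIV UNIV ?H"
    by (intro metric_outer_measure_borel metric_outer_measure_hausdorff)
  have ca_borel: "countably_additive (sets borel) ?H"
  proof (rule countably_additiveI)
    fix B :: "nat \<Rightarrow> 'a set"
    assume "range B \<subseteq> sets borel" "disjoint_family B" "(\<Union>i. B i) \<in> sets borel"
    with borel have "range B \<subseteq> lambda_system UNIV UNIV ?H" "(\<Union>i. B i) \<in> lambda_system UNIV UNIV ?H"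
      by blast+
    then show "(\<Sum>i. ?H (B i)) = ?H (\<Union>i. B i)"
      using ca \<open>disjoint_family B\<close> unfolding countably_additive_def by blast
  qed
  have pos: "positive (sets borel) ?H"
    using oms by (simp add: outer_measure_space_def positive_def)
  have sa: "sigma_algebra UNIV (sets (borel :: 'a measure))"
    using sets.sigma_algebra_axioms[of "borel :: 'a measure"] by simp
  show ?thesis
    unfolding hausdorff_measure_def by (rule emeasure_measure_of_sigma[OF sa pos ca_borel assms])
qed



section \<open>The sphere has finite Hausdorff measure\<close>

text \<open>The factor \<open>s\<close> on the right is what lowers the exponent from \<open>n\<close> to \<open>n - 1\<close> in the volume count
  that follows.\<close>
lemma annulus_power_le:
  fixes s :: real
  assumes "0 \<le> s" "s \<le> 1"
  shows "(1 + s) ^ n - (1 - s) ^ n \<le> (2 ^ n + real n) * s"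
proof -
  have "(1 + s) ^ n \<le> 1 + (2 ^ n - 1) * s"
  proof (induction n)
    case (Suc n)
    have "(1 + s) ^ Suc n \<le> (1 + (2 ^ n - 1) * s) * (1 + s)"
      using Suc assms by (simp add: mult_left_mono mult.commute)
    also have "\<dots> \<le> 1 + (2 ^ Suc n - 1) * s"
    proof -
      have "(2 ^ n - 1) * (s * s) \<le> (2 ^ n - 1) * (s * 1)"
        using assms by (intro mult_left_mono) auto
      then show ?thesis by (simp add: algebra_simps)
    qed
    finally show ?case .
  qed simp
  moreover have "1 - real n * s \<le> (1 - s) ^ n"
    using Bernoulli_inequality[of "- s" n] assms by simp
  moreover have "(2 ^ n - 1) * s \<le> 2 ^ n * s"
    using assms by (intro mult_right_mono) auto
  ultimately show ?thesis by (simp add: algebra_simps)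
qed

text \<open>The balls of radius \<open>r/2\<close> about the points of \<open>P\<close> are disjoint and contained in the annulus with
  radii \<open>1 - r/2\<close> and \<open>1 + r/2\<close>, whose volume is of order \<open>r\<close>.\<close>
lemma card_separated_sphere_le:
  fixes P :: "'a::euclidean_space set"
  assumes P: "finite P" "P \<subseteq> sphere 0 1" and r: "0 < r" "r \<le> 1"
    and sep: "\<And>p q. p \<in> P \<Longrightarrow> q \<in> P \<Longrightarrow> p \<noteq> q \<Longrightarrow> r \<le> dist p q"
  shows "real (card P) * (r / 2) ^ (DIM('a) - 1) \<le> 2 ^ DIM('a) + real DIM('a)"
proof -
  let ?n = "DIM('a)" and ?w = "unit_ball_vol (real DIM('a))" and ?s = "r / 2"
  have w: "?w > 0" by simp
  have power_n: "?s ^ ?n = ?s * ?s ^ (?n - 1)"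
    by (metis DIM_positive mult.commute power_minus_mult)
  have disj: "disjoint_family_on (\<lambda>p. ball p ?s) P"
    unfolding disjoint_family_on_def
  proof (intro ballI impI)
    fix p q assume "p \<in> P" "q \<in> P" "p \<noteq> q"
    then show "ball p ?s \<inter> ball q ?s = {}"
      using sep[of p q] by (auto simp: disjoint_ballI)
  qed
  have "real (card P) * (?w * ?s ^ ?n) = (\<Sum>p\<in>P. measure lborel (ball p ?s))"
    using r by (simp add: content_ball)
  also have "\<dots> = measure lborel (\<Union>p\<in>P. ball p ?s)"
    using P disj emeasure_bounded_finite[of "ball _ ?s"]
    by (intro measure_finite_Union[symmetric]) (auto simp: less_top)
  also have "\<dots> \<le> measure lborel (cball 0 (1 + ?s) - ball (0::'a) (1 - ?s))"
  proof (rule measure_mono_fmeasurable)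
    show "(\<Union>p\<in>P. ball p ?s) \<subseteq> cball 0 (1 + ?s) - ball 0 (1 - ?s)"
    proof
      fix x assume "x \<in> (\<Union>p\<in>P. ball p ?s)"
      then obtain p where p: "norm p = 1" "dist p x < ?s" using P by auto
      have "norm x \<le> norm p + dist p x" "norm p \<le> norm x + dist p x"
        unfolding dist_norm by norm+
      with p show "x \<in> cball 0 (1 + ?s) - ball 0 (1 - ?s)" by auto
    qed
    show "cball 0 (1 + ?s) - ball 0 (1 - ?s) \<in> fmeasurable lborel"
      by (rule fmeasurable_Diff[OF fmeasurable_compact]) auto
    show "(\<Union>p\<in>P. ball p ?s) \<in> sets lborel"
      using P(1) by (intro sets.finite_UN) auto
  qed
  also have "\<dots> = measure lborel (cball (0::'a) (1 + ?s)) - measure lborel (ball (0::'a) (1 - ?s))"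
    using r by (intro measurable_measure_Diff fmeasurable_compact compact_cball) auto
  also have "\<dots> = ?w * ((1 + ?s) ^ ?n - (1 - ?s) ^ ?n)"
    using r by (simp add: content_ball content_cball algebra_simps)
  also have "\<dots> \<le> ?w * ((2 ^ ?n + real ?n) * ?s)"
    using r by (intro mult_left_mono annulus_power_le) auto
  finally have "(?w * ?s) * (real (card P) * ?s ^ (?n - 1)) \<le> (?w * ?s) * (2 ^ ?n + real ?n)"
    unfolding power_n by (simp only: mult_ac)
  moreover have "0 < ?w * ?s" using w r by simp
  ultimately show ?thesis
    by (rule mult_left_le_imp_le)
qed

text \<open>A separated subset of largest cardinality is also a net: a point of the sphere at distance more
  than \<open>r\<close> from it could be added.\<close>
lemma sphere_net:
  assumes r: "0 < r" "r \<le> 1"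
  obtains P :: "'a::euclidean_space set" where "finite P" "sphere 0 1 \<subseteq> (\<Union>p\<in>P. cball p r)"
    "real (card P) * (r / 2) ^ (DIM('a) - 1) \<le> 2 ^ DIM('a) + real DIM('a)"
proof -
  define Sep where "Sep = (\<lambda>P::'a set. finite P \<and> P \<subseteq> sphere 0 1 \<and>
    (\<forall>p\<in>P. \<forall>q\<in>P. p \<noteq> q \<longrightarrow> r \<le> dist p q))"
  have bound: "real (card P) * (r / 2) ^ (DIM('a) - 1) \<le> 2 ^ DIM('a) + real DIM('a)" if "Sep P" for P
    using that r by (intro card_separated_sphere_le) (auto simp: Sep_def)
  obtain N :: nat where N: "(2 ^ DIM('a) + real DIM('a)) / (r / 2) ^ (DIM('a) - 1) < real N"
    using reals_Archimedean2 by blast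
  have "card P < N" if "Sep P" for P
  proof -
    have "real (card P) \<le> (2 ^ DIM('a) + real DIM('a)) / (r / 2) ^ (DIM('a) - 1)"
      using bound[OF that] r by (simp add: pos_le_divide_eq)
    with N show ?thesis by linarith
  qed
  moreover have "Sep {}" by (simp add: Sep_def)
  ultimately obtain P where P: "Sep P" and max: "\<And>P'. Sep P' \<Longrightarrow> card P' \<le> card P"
    using ex_has_greatest_nat[of Sep "{}" card N] by blast
  have "sphere 0 1 \<subseteq> (\<Union>p\<in>P. cball p r)"
  proof (rule ccontr)
    assume "\<not> ?thesis"
    then obtain x where x: "x \<in> sphere 0 1" "\<And>p. p \<in> P \<Longrightarrow> r < dist p x" by force
    have "Sep (insert x P)"
      using P x by (auto simp: Sep_def dist_commute less_imp_le)
    moreover have "x \<notin> P" using x(2)[of x] r by auto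
    ultimately show False
      using max[of "insert x P"] P by (auto simp: Sep_def)
  qed
  with P bound that show ?thesis by (auto simp: Sep_def)
qed

theorem hausdorff_outer_measure_sphere_finite:
  "hausdorff_outer_measure (DIM('a) - 1) (sphere (0::'a::euclidean_space) 1) < top"
proof -
  let ?k = "DIM('a) - 1"
  let ?C = "unit_ball_vol (real ?k) * (2 ^ DIM('a) + real DIM('a)) * 2 ^ ?k"
  have "hausdorff_premeasure ?k d (sphere (0::'a) 1) \<le> ennreal ?C" if "d > 0" for d
  proof -
    \<comment> \<open>Balls of radius \<open>r\<close> have diameter \<open>2 * r \<le> d\<close>.\<close>
    define r where "r = min 1 (d / 2)"
    have r: "0 < r" "r \<le> 1" "2 * r \<le> d" using that by (auto simp: r_def)
    obtain P :: "'a set" where P: "finite P" "sphere 0 1 \<subseteq> (\<Union>p\<in>P. cball p r)"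
      "real (card P) * (r / 2) ^ ?k \<le> 2 ^ DIM('a) + real DIM('a)"
      using sphere_net[OF r(1,2)] by metis
    obtain h where h: "bij_betw h {..<card P} P"
      using P(1) ex_bij_betw_nat_finite by (metis atLeast0LessThan)
    define U where "U = (\<lambda>i. if i < card P then cball (h i) r else {})"
    have "hausdorff_premeasure ?k d (sphere (0::'a) 1) \<le> (\<Sum>i. hausdorff_gauge ?k (U i))"
    proof (rule hausdorff_premeasure_le)
      show "sphere 0 1 \<subseteq> (\<Union>i. U i)"
      proof
        fix x :: 'a assume "x \<in> sphere 0 1"
        with P(2) obtain p where p: "p \<in> P" "x \<in> cball p r" by auto
        then have "p \<in> h ` {..<card P}"
          using bij_betw_imp_surj_on[OF h] by simp
        then obtain i where "i < card P" "h i = p" by auto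
        with p show "x \<in> (\<Union>i. U i)" by (auto simp: U_def)
      qed
      show "bounded (U i)" "diameter (U i) \<le> d" for i
        using r that by (auto simp: U_def)
    qed
    also have "\<dots> = (\<Sum>i<card P. hausdorff_gauge ?k (U i))"
      by (intro suminf_finite) (auto simp: U_def)
    also have "\<dots> = (\<Sum>i<card P. ennreal (unit_ball_vol (real ?k) / 2 ^ ?k * (2 * r) ^ ?k))"
      using r by (intro sum.cong) (auto simp: U_def hausdorff_gauge_def)
    also have "\<dots> = ennreal (real (card P) * (unit_ball_vol (real ?k) / 2 ^ ?k * (2 * r) ^ ?k))"
      using r by (simp add: ennreal_mult' ennreal_of_nat_eq_real_of_nat)
    also have "real (card P) * (unit_ball_vol (real ?k) / 2 ^ ?k * (2 * r) ^ ?k)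
        = unit_ball_vol (real ?k) * (real (card P) * (r / 2) ^ ?k) * 2 ^ ?k"
      by (simp add: power_mult_distrib power_divide)
    also have "ennreal \<dots> \<le> ennreal ?C"
      using P(3) by (intro ennreal_leI mult_left_mono mult_right_mono) auto
    finally show ?thesis .
  qed
  then have "hausdorff_outer_measure ?k (sphere (0::'a) 1) \<le> ennreal ?C"
    unfolding hausdorff_outer_measure_def by (intro SUP_least) auto
  then show ?thesis using le_less_trans ennreal_less_top by blast
qed

section \<open>Open pieces of the sphere have positive Hausdorff measure\<close>

definition cone_over :: "'a::real_vector set \<Rightarrow> 'a set" where
  "cone_over V = (\<lambda>(t, x). t *\<^sub>R x) ` ({0..1} \<times> V)"

lemma compact_cone_over: "compact V \<Longrightarrow> compact (cone_over (V :: 'a::real_normed_vector set))"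
  unfolding cone_over_def split_def
  by (intro compact_continuous_image continuous_intros compact_Times compact_Icc)

text \<open>Every point \<open>t x\<close> of the cone is within \<open>2 e\<close> of one of the points \<open>(j/m) x0\<close> on a single generating
  segment, where \<open>m\<close> is about \<open>1/e\<close>.  Hence about \<open>1/e\<close> balls of volume of order \<open>e\<^sup>n\<close> cover the cone.\<close>
lemma emeasure_cone_over_le:
  fixes V :: "'a::euclidean_space set"
  assumes V: "compact V" "V \<subseteq> sphere 0 1" and e: "0 < e" "e \<le> 1"
    and diam: "\<And>x y. x \<in> V \<Longrightarrow> y \<in> V \<Longrightarrow> dist x y \<le> e"
  shows "emeasure lborel (cone_over V) \<le>
    ennreal (3 * 2 ^ DIM('a) * unit_ball_vol DIM('a) * e ^ (DIM('a) - 1))"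
proof (cases "V = {}")
  case False
  then obtain x0 where x0: "x0 \<in> V" by blast
  let ?n = "DIM('a)" and ?w = "unit_ball_vol (real DIM('a))"
  define m where "m = nat \<lceil>1 / e\<rceil>"
  have m: "1 / e \<le> real m" "real m \<le> 1 / e + 1"
    unfolding m_def by (rule real_nat_ceiling_ge) (use e in \<open>simp add: of_nat_ceiling; linarith\<close>)
  have m0: "0 < m"
    using m(1) e by (cases m) (auto simp: field_simps)
  have inv: "1 / real m \<le> e"
    using m m0 e by (simp add: field_simps)
  have sub: "cone_over V \<subseteq> (\<Union>j\<le>m. cball ((real j / real m) *\<^sub>R x0) (2 * e))"
  proof
    fix y assume "y \<in> cone_over V"
    then obtain t x where y: "y = t *\<^sub>R x" "0 \<le> t" "t \<le> 1" "x \<in> V"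
      by (auto simp: cone_over_def)
    define j where "j = nat \<lfloor>t * real m\<rfloor>"
    have j: "real j \<le> t * real m" "t * real m \<le> real j + 1"
      using y by (auto simp: j_def)
    have "real j \<le> real m" using j(1) y mult_right_mono[of t 1 "real m"] by simp
    then have jm: "j \<le> m" by simp
    have "real j / real m \<le> t" "t \<le> real j / real m + 1 / real m"
      using j m0 by (simp_all add: field_simps)
    then have abs: "\<bar>t - real j / real m\<bar> \<le> e" using inv by linarith
    have "norm (t *\<^sub>R x - (real j / real m) *\<^sub>R x0)
        = norm (t *\<^sub>R (x - x0) + (t - real j / real m) *\<^sub>R x0)"
      by (simp add: algebra_simps)
    also have "\<dots> \<le> \<bar>t\<bar> * norm (x - x0) + \<bar>t - real j / real m\<bar> * norm x0"
      by (metis norm_scaleR norm_triangle_ineq)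
    also have "\<dots> \<le> 1 * e + e * 1"
      using y abs diam[of x x0] x0 V e by (intro add_mono mult_mono) (auto simp: dist_norm)
    finally have "y \<in> cball ((real j / real m) *\<^sub>R x0) (2 * e)"
      using y by (simp add: dist_norm norm_minus_commute)
    with jm show "y \<in> (\<Union>j\<le>m. cball ((real j / real m) *\<^sub>R x0) (2 * e))" by blast
  qed
  have "emeasure lborel (cone_over V) \<le> emeasure lborel (\<Union>j\<le>m. cball ((real j / real m) *\<^sub>R x0) (2 * e))"
    using sub by (intro emeasure_mono) auto
  also have "\<dots> \<le> (\<Sum>j\<le>m. emeasure lborel (cball ((real j / real m) *\<^sub>R x0) (2 * e)))"
    by (intro emeasure_subadditive_finite) auto
  also have "\<dots> = ennreal ((real m + 1) * (?w * (2 * e) ^ ?n))"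
    using e by (simp add: emeasure_cball ennreal_mult' ennreal_of_nat_eq_real_of_nat)
      (metis add.commute ennreal_of_nat_eq_real_of_nat of_nat_Suc)
  also have "\<dots> \<le> ennreal (3 / e * (?w * (2 * e) ^ ?n))"
  proof (intro ennreal_leI mult_right_mono)
    have "1 \<le> 1 / e" using e by simp
    with m(2) show "real m + 1 \<le> 3 / e" by (simp add: add_divide_distrib)
  qed (use e in auto)
  also have "3 / e * (?w * (2 * e) ^ ?n) = 3 * 2 ^ ?n * ?w * (e ^ ?n / e)"
    by (simp add: power_mult_distrib)
  also have "e ^ ?n / e = e ^ (?n - 1)"
    using e by (simp add: power_diff)
  finally show ?thesis .
qed (simp add: cone_over_def)

text \<open>The passage to the limit \<open>e \<rightarrow> diameter V\<close> includes singletons.  For them the bound is 0 if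
  \<open>DIM('a) > 1\<close>; on the real line the exponent is 0 and the bound is a positive constant, in
  accordance with the value 1 that a singleton has under 0-dimensional Hausdorff measure.\<close>
lemma emeasure_cone_over_le_diameter:
  fixes V :: "'a::euclidean_space set"
  assumes V: "compact V" "V \<subseteq> sphere 0 1" and diam: "diameter V < 1"
  shows "emeasure lborel (cone_over V) \<le>
    ennreal (3 * 2 ^ DIM('a) * unit_ball_vol DIM('a) * diameter V ^ (DIM('a) - 1))"
proof -
  let ?g = "\<lambda>e. 3 * 2 ^ DIM('a) * unit_ball_vol DIM('a) * e ^ (DIM('a) - 1)"
  have d0: "0 \<le> diameter V" using V diameter_ge_0 compact_imp_bounded by blast
  have "((\<lambda>e. ennreal (?g e)) \<longlongrightarrow> ennreal (?g (diameter V))) (at_right (diameter V))"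
    by (intro tendsto_ennrealI tendsto_intros)
  moreover have "\<forall>\<^sub>F e in at_right (diameter V). emeasure lborel (cone_over V) \<le> ennreal (?g e)"
    using eventually_at_right_real[OF diam]
  proof eventually_elim
    case (elim e)
    have "dist x y \<le> e" if "x \<in> V" "y \<in> V" for x y
      using diameter_bounded_bound[OF compact_imp_bounded[OF V(1)] that] elim by auto
    with V d0 elim show ?case
      by (intro emeasure_cone_over_le) auto
  qed
  ultimately show ?thesis
    by (intro tendsto_lowerbound) auto
qed

text \<open>Comparison of any cover of \<open>sphere 0 1 \<inter> T\<close> with the volume of the open set \<open>W\<close>, which is the cone
  over \<open>sphere 0 1 \<inter> T\<close> without its apex and its base.\<close>
theorem hausdorff_outer_measure_sphere_open_pos:
  fixes T :: "'a::euclidean_space set"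
  assumes T: "open T" "sphere 0 1 \<inter> T \<noteq> {}"
  shows "0 < hausdorff_outer_measure (DIM('a) - 1) (sphere 0 1 \<inter> T)"
proof -
  let ?k = "DIM('a) - 1"
  define W where "W = {y. 0 < norm y \<and> norm y < 1 \<and> (1 / norm y) *\<^sub>R y \<in> T}"
  have "open ((-{0}) \<inter> (\<lambda>y. (1 / norm y) *\<^sub>R y) -` T)"
    using T(1) by (intro continuous_open_preimage continuous_intros) auto
  then have "open (ball 0 1 \<inter> ((-{0}) \<inter> (\<lambda>y. (1 / norm y) *\<^sub>R y) -` T))"
    by (rule open_Int[OF open_ball])
  also have "ball 0 1 \<inter> ((-{0}) \<inter> (\<lambda>y. (1 / norm y) *\<^sub>R y) -` T) = W"
    by (auto simp: W_def)
  finally have openW: "open W" .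
  obtain u where "norm u = 1" "u \<in> T" using T by auto
  then have "(1/2) *\<^sub>R u \<in> W" by (auto simp: W_def)
  with openW obtain e where e: "e > 0" "ball ((1/2) *\<^sub>R u) e \<subseteq> W"
    using open_contains_ball by blast
  have "0 < emeasure lborel (ball ((1/2) *\<^sub>R u) e)"
    using e(1) by (simp add: emeasure_ball)
  also have "\<dots> \<le> emeasure lborel W"
    using e(2) openW by (intro emeasure_mono) auto
  finally have Wpos: "0 < emeasure lborel W" .
  have W_cone: "\<exists>t x. y = t *\<^sub>R x \<and> 0 \<le> t \<and> t \<le> 1 \<and> x \<in> sphere 0 1 \<inter> T" if "y \<in> W" for y
    using that by (intro exI[of _ "norm y"] exI[of _ "(1 / norm y) *\<^sub>R y"]) (auto simp: W_def)
  define wk where "wk = unit_ball_vol (real ?k)"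
  have wk: "wk > 0" unfolding wk_def by (rule unit_ball_vol_pos) simp
  \<comment> \<open>The constant of the cone estimate, divided by the normalization \<open>wk / 2 ^ (n - 1)\<close> of the gauge.\<close>
  define C where "C = 3 * 2 ^ DIM('a) * unit_ball_vol (real DIM('a)) * 2 ^ ?k / wk"
  have C: "C > 0" using wk by (simp add: C_def)
  \<comment> \<open>Any bound below 1 on the diameters would do; below it the cone estimate applies.\<close>
  have "emeasure lborel W / ennreal C \<le> hausdorff_premeasure ?k (1/2) (sphere 0 1 \<inter> T)"
    unfolding hausdorff_premeasure_eq_INF
  proof (rule INF_greatest)
    fix U :: "nat \<Rightarrow> 'a set"
    assume "U \<in> {U. sphere 0 1 \<inter> T \<subseteq> (\<Union>i. U i) \<and> (\<forall>i. bounded (U i) \<and> diameter (U i) \<le> 1/2)}"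
    then have U: "sphere 0 1 \<inter> T \<subseteq> (\<Union>i. U i)" "\<And>i. bounded (U i)" "\<And>i. diameter (U i) \<le> 1/2"
      by blast+
    \<comment> \<open>Closures keep the diameter and make the cones compact, hence Borel sets.\<close>
    define V where "V = (\<lambda>i. closure (U i \<inter> sphere 0 1))"
    have V: "compact (V i)" "V i \<subseteq> sphere 0 1" "diameter (V i) \<le> diameter (U i)" for i
    proof -
      show "compact (V i)" unfolding V_def
        by (simp add: compact_closure bounded_Int)
      show "V i \<subseteq> sphere 0 1" unfolding V_def
        by (intro closure_minimal) auto
      show "diameter (V i) \<le> diameter (U i)" unfolding V_def
        using U(2)[of i] by (simp add: diameter_closure diameter_subset bounded_Int)
    qed
    have "W \<subseteq> (\<Union>i. cone_over (V i))"
    proof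
      fix y assume "y \<in> W"
      then obtain t x where y: "y = t *\<^sub>R x" "0 \<le> t" "t \<le> 1" "x \<in> sphere 0 1 \<inter> T"
        using W_cone by blast
      then obtain i where "x \<in> U i" using subsetD[OF U(1)] by auto
      with y have "x \<in> U i \<inter> sphere 0 1" by auto
      then have "x \<in> V i" unfolding V_def by (rule subsetD[OF closure_subset])
      with y show "y \<in> (\<Union>i. cone_over (V i))"
        by (auto simp: cone_over_def intro!: exI[of _ i] image_eqI[of _ _ "(t, x)"])
    qed
    then have "emeasure lborel W \<le> emeasure lborel (\<Union>i. cone_over (V i))"
      using V by (intro emeasure_mono sets.countable_UN) (auto intro!: borel_compact compact_cone_over)
    also have "\<dots> \<le> (\<Sum>i. emeasure lborel (cone_over (V i)))"
      using V by (intro emeasure_subadditive_countably) (auto intro!: borel_compact compact_cone_over)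
    also have "\<dots> \<le> (\<Sum>i. hausdorff_gauge ?k (U i) * ennreal C)"
    proof (intro suminf_le summableI)
      fix i
      show "emeasure lborel (cone_over (V i)) \<le> hausdorff_gauge ?k (U i) * ennreal C"
      proof (cases "U i = {}")
        case True
        then show ?thesis by (simp add: V_def cone_over_def)
      next
        case False
        have dV: "0 \<le> diameter (V i)" using V diameter_ge_0 compact_imp_bounded by blast
        have "emeasure lborel (cone_over (V i)) \<le>
            ennreal (3 * 2 ^ DIM('a) * unit_ball_vol DIM('a) * diameter (V i) ^ ?k)"
          using V[of i] U(3)[of i] by (intro emeasure_cone_over_le_diameter) auto
        also have "\<dots> \<le> ennreal (3 * 2 ^ DIM('a) * unit_ball_vol DIM('a) * diameter (U i) ^ ?k)"
          using V(3)[of i] dV by (intro ennreal_leI mult_left_mono power_mono) auto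
        also have "3 * 2 ^ DIM('a) * unit_ball_vol DIM('a) * diameter (U i) ^ ?k
            = wk / 2 ^ ?k * diameter (U i) ^ ?k * C"
          using wk by (simp add: C_def field_simps)
        also have "ennreal \<dots> = hausdorff_gauge ?k (U i) * ennreal C"
          using False C wk diameter_ge_0[OF U(2)[of i]]
          unfolding hausdorff_gauge_def wk_def[symmetric] if_not_P[OF False]
          by (subst ennreal_mult[symmetric]) auto
        finally show ?thesis .
      qed
    qed
    also have "\<dots> = (\<Sum>i. hausdorff_gauge ?k (U i)) * ennreal C"
      by simp
    finally show "emeasure lborel W / ennreal C \<le> (\<Sum>i. hausdorff_gauge ?k (U i))"
      using C by (intro divide_le_posI_ennreal) (auto simp: mult.commute)
  qed
  also have "\<dots> \<le> hausdorff_outer_measure ?k (sphere 0 1 \<inter> T)"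
    by (rule hausdorff_premeasure_le_outer) simp
  finally show ?thesis
    using Wpos by (metis ennreal_divide_eq_0_iff ennreal_neq_top not_gr_zero le_zero_eq)
qed



section \<open>Integration of continuous functions over the sphere\<close>

definition sphere_measure :: "'a::euclidean_space measure" where
  "sphere_measure = restrict_space (hausdorff_measure (DIM('a) - 1)) (sphere 0 1)"

lemma space_sphere_measure [simp]: "space sphere_measure = sphere 0 1"
  by (simp add: sphere_measure_def space_restrict_space)

lemma set_integral_sphere_eq:
  fixes f :: "'a::euclidean_space \<Rightarrow> real"
  shows "(LINT u : sphere 0 1 | hausdorff_measure (DIM('a) - 1). f u) = integral\<^sup>L sphere_measure f"
  unfolding sphere_measure_def set_lebesgue_integral_def
  by (subst integral_restrict_space) auto

lemma finite_measure_sphere_measure: "finite_measure (sphere_measure :: 'a::euclidean_space measure)"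
proof
  show "emeasure sphere_measure (space (sphere_measure :: 'a measure)) \<noteq> \<infinity>"
    using hausdorff_outer_measure_sphere_finite[where 'a='a]
    by (simp add: sphere_measure_def space_restrict_space emeasure_restrict_space emeasure_hausdorff_measure)
qed

lemma borel_measurable_sphere_measure:
  fixes f :: "'a::euclidean_space \<Rightarrow> real"
  assumes "continuous_on (sphere 0 1) f"
  shows "f \<in> borel_measurable sphere_measure"
proof -
  have "sets (sphere_measure :: 'a measure) = sets (restrict_space borel (sphere 0 1))"
    unfolding sphere_measure_def by (intro sets_restrict_space_cong) simp
  with borel_measurable_continuous_on_restrict[OF assms] show ?thesis
    using measurable_cong_sets by blast
qed

lemma integrable_sphere_measure:
  fixes f :: "'a::euclidean_space \<Rightarrow> real"
  assumes "continuous_on (sphere 0 1) f"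
  shows "integrable sphere_measure f"
proof -
  have "bounded (f ` sphere 0 1)"
    by (intro compact_imp_bounded compact_continuous_image assms) auto
  then obtain B where "\<And>u. u \<in> sphere 0 1 \<Longrightarrow> norm (f u) \<le> B"
    unfolding bounded_iff by blast
  then show ?thesis
    by (intro finite_measure.integrable_const_bound[OF finite_measure_sphere_measure, of f B]
        borel_measurable_sphere_measure assms AE_I2) simp
qed

text \<open>A point where \<open>g\<close> is positive would have a relatively open neighbourhood on which \<open>g\<close> is positive,
  and such a neighbourhood is not a null set.\<close>
lemma integral_sphere_eq_0_imp:
  fixes g :: "'a::euclidean_space \<Rightarrow> real"
  assumes cont: "continuous_on (sphere 0 1) g" and nonneg: "\<And>u. u \<in> sphere 0 1 \<Longrightarrow> 0 \<le> g u"
    and int: "integral\<^sup>L sphere_measure g = 0" and u: "u \<in> sphere 0 1"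
  shows "g u = 0"
proof (rule ccontr)
  assume "g u \<noteq> 0"
  with nonneg[OF u] have gu: "g u \<in> {0<..}" by simp
  obtain T where T: "open T" "T \<inter> sphere 0 1 = g -` {0<..} \<inter> sphere 0 1"
    using cont open_greaterThan unfolding continuous_on_open_invariant by metis
  with gu u have "sphere 0 1 \<inter> T \<noteq> {}" by blast
  with T(1) have "0 < hausdorff_outer_measure (DIM('a) - 1) (sphere 0 1 \<inter> T)"
    by (rule hausdorff_outer_measure_sphere_open_pos)
  also have "\<dots> = emeasure sphere_measure (sphere 0 1 \<inter> T)"
    using T(1) by (simp add: sphere_measure_def emeasure_restrict_space emeasure_hausdorff_measure)
  finally have pos: "0 < emeasure sphere_measure (sphere 0 1 \<inter> T)" .
  have "AE v in sphere_measure. g v = 0"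
    using int nonneg integrable_sphere_measure[OF cont]
    by (subst (asm) integral_nonneg_eq_0_iff_AE) auto
  moreover have "g v > 0" if "v \<in> sphere 0 1 \<inter> T" for v
  proof -
    have "v \<in> g -` {0<..} \<inter> sphere 0 1" using T(2) that by blast
    then show ?thesis by simp
  qed
  ultimately have "AE v in sphere_measure. v \<notin> sphere 0 1 \<inter> T"
    by (auto elim!: eventually_mono dest: less_imp_neq[symmetric])
  moreover have "sphere 0 1 \<inter> T \<in> sets sphere_measure"
    using T(1) by (auto simp: sphere_measure_def sets_restrict_space_iff)
  ultimately have "sphere 0 1 \<inter> T \<in> null_sets sphere_measure"
    using AE_iff_null_sets by blast
  with pos show False by (simp add: null_setsD1)
qed

lemma integral_sphere_pos:
  fixes g :: "'a::euclidean_space \<Rightarrow> real"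
  assumes "continuous_on (sphere 0 1) g" and pos: "\<And>u. u \<in> sphere 0 1 \<Longrightarrow> 0 < g u"
  shows "0 < integral\<^sup>L sphere_measure g"
proof -
  obtain u :: 'a where u: "u \<in> sphere 0 1"
    using vector_choose_size[of 1] by auto
  have "0 \<le> integral\<^sup>L sphere_measure g"
    using pos by (intro integral_nonneg_AE AE_I2) (auto intro: less_imp_le)
  moreover have "integral\<^sup>L sphere_measure g \<noteq> 0"
    using integral_sphere_eq_0_imp[OF assms(1) _ _ u] pos u by (metis less_irrefl less_imp_le)
  ultimately show ?thesis by simp
qed

section \<open>Jensen's inequality on the sphere\<close>

lemma strictly_convex_on_imp_convex_on:
  assumes "strictly_convex_on S f" shows "convex_on S f"
proof (rule convex_onI)
  show "convex S" using assms by (simp add: strictly_convex_on_def)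
  fix t :: real and x y assume *: "0 < t" "t < 1" "x \<in> S" "y \<in> S"
  show "f ((1 - t) *\<^sub>R x + t *\<^sub>R y) \<le> (1 - t) * f x + t * f y"
  proof (cases "x = y")
    case True
    then show ?thesis by (simp add: algebra_simps flip: scaleR_add_left)
  next
    case False
    with assms * have "f ((1 - t) *\<^sub>R x + t *\<^sub>R y) < (1 - t) * f x + t * f y"
      unfolding strictly_convex_on_def by (metis add.commute diff_add_cancel diff_gt_0_iff_gt)
    then show ?thesis by simp
  qed
qed

lemma convex_supporting_line:
  fixes \<psi> :: "real \<Rightarrow> real"
  assumes "convex_on I \<psi>" "open I" "m \<in> I"
  obtains s where "\<And>y. y \<in> I \<Longrightarrow> \<psi> m + s * (y - m) \<le> \<psi> y"
  using convex_le_Inf_differential[OF assms(1)] assms(2,3) by (metis interior_open)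

text \<open>By strict convexity, a line through two points of the graph lies strictly above it at their
  midpoint, which a supporting line cannot do.\<close>
lemma strictly_convex_supporting_line:
  fixes \<psi> :: "real \<Rightarrow> real"
  assumes \<psi>: "strictly_convex_on I \<psi>" and I: "m \<in> I" "y \<in> I"
    and s: "\<And>y. y \<in> I \<Longrightarrow> \<psi> m + s * (y - m) \<le> \<psi> y"
    and eq: "\<psi> y = \<psi> m + s * (y - m)"
  shows "y = m"
proof (rule ccontr)
  assume "y \<noteq> m"
  let ?z = "(1/2) *\<^sub>R y + (1/2) *\<^sub>R m"
  have "?z \<in> I"
    using \<psi> I convexD[of I y m "1/2" "1/2"] by (simp add: strictly_convex_on_def)
  then have "\<psi> m + s * (?z - m) \<le> \<psi> ?z" by (rule s)
  also have "\<psi> ?z < 1/2 * \<psi> y + 1/2 * \<psi> m"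
  proof -
    have "\<forall>u>0. \<forall>v>0. u + v = 1 \<longrightarrow> \<psi> (u *\<^sub>R y + v *\<^sub>R m) < u * \<psi> y + v * \<psi> m"
      using \<psi> I \<open>y \<noteq> m\<close> unfolding strictly_convex_on_def by blast
    from this[rule_format, of "1/2" "1/2"] show ?thesis by simp
  qed
  also have "\<dots> = \<psi> m + s * (?z - m)"
    by (simp add: eq field_simps)
  finally show False by simp
qed

definition weighted_sphere_mean :: "('a::euclidean_space \<Rightarrow> real) \<Rightarrow> ('a \<Rightarrow> real) \<Rightarrow> real" where
  "weighted_sphere_mean w X = (LINT u|sphere_measure. X u * w u) / integral\<^sup>L sphere_measure w"

context
  fixes w X :: "'a::euclidean_space \<Rightarrow> real"
  assumes w: "continuous_on (sphere 0 1) w" "\<And>u. u \<in> sphere 0 1 \<Longrightarrow> 0 < w u"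
    and X: "continuous_on (sphere 0 1) X" "\<And>u. u \<in> sphere 0 1 \<Longrightarrow> 0 < X u"
begin

lemma weighted_sphere_mean_pos: "0 < weighted_sphere_mean w X"
proof -
  have "0 < (LINT u|sphere_measure. X u * w u)"
    by (rule integral_sphere_pos[OF continuous_on_mult[OF X(1) w(1)]]) (simp add: w X)
  then show ?thesis
    using integral_sphere_pos[OF w] by (simp add: weighted_sphere_mean_def)
qed

lemma weighted_sphere_mean_const:
  assumes "\<And>u. u \<in> sphere 0 1 \<Longrightarrow> X u = c"
  shows "weighted_sphere_mean w X = c"
proof -
  have "(LINT u|sphere_measure. X u * w u) = (LINT u|sphere_measure. c * w u)"
    by (intro Bochner_Integration.integral_cong) (simp_all add: assms)
  then show ?thesis
    using integral_sphere_pos[OF w] by (simp add: weighted_sphere_mean_def)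
qed

context
  fixes \<psi> :: "real \<Rightarrow> real" and m :: real
  assumes \<psi>: "continuous_on {0<..} \<psi>" and m: "m = weighted_sphere_mean w X"
begin

lemma continuous_on_sphere_comp: "continuous_on (sphere 0 1) (\<lambda>u. \<psi> (X u))"
  using X by (intro continuous_on_compose2[OF \<psi> X(1)]) auto

text \<open>The linear term drops out for every slope \<open>s\<close>, because \<open>m\<close> is the mean of \<open>X\<close>; so the integrated
  gap between \<open>\<psi>\<close> and a line through \<open>(m, \<psi> m)\<close> is the defect in Jensen's inequality.\<close>
lemma sphere_jensen_gap:
  "(LINT u|sphere_measure. (\<psi> (X u) - \<psi> m - s * (X u - m)) * w u) =
     (LINT u|sphere_measure. \<psi> (X u) * w u) - integral\<^sup>L sphere_measure w * \<psi> m"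
proof -
  note int = integrable_sphere_measure
  have "(LINT u|sphere_measure. (\<psi> (X u) - \<psi> m - s * (X u - m)) * w u) =
      (LINT u|sphere_measure. \<psi> (X u) * w u - \<psi> m * w u - s * (X u * w u - m * w u))"
    by (intro Bochner_Integration.integral_cong) (simp_all add: algebra_simps)
  also have "\<dots> = (LINT u|sphere_measure. \<psi> (X u) * w u) - \<psi> m * integral\<^sup>L sphere_measure w
      - s * ((LINT u|sphere_measure. X u * w u) - m * integral\<^sup>L sphere_measure w)"
    using int[OF w(1)] int[OF continuous_on_mult[OF X(1) w(1)]]
      int[OF continuous_on_mult[OF continuous_on_sphere_comp w(1)]]
    by simp
  also have "(LINT u|sphere_measure. X u * w u) = m * integral\<^sup>L sphere_measure w"
    using integral_sphere_pos[OF w] by (simp add: m weighted_sphere_mean_def)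
  finally show ?thesis by simp
qed

lemma sphere_jensen:
  assumes "convex_on {0<..} \<psi>"
  shows "integral\<^sup>L sphere_measure w * \<psi> m \<le> (LINT u|sphere_measure. \<psi> (X u) * w u)"
proof -
  obtain s where s: "\<And>y. y \<in> {0<..} \<Longrightarrow> \<psi> m + s * (y - m) \<le> \<psi> y"
    using convex_supporting_line[OF assms, of m] weighted_sphere_mean_pos m by auto
  have "0 \<le> (LINT u|sphere_measure. (\<psi> (X u) - \<psi> m - s * (X u - m)) * w u)"
  proof (intro integral_nonneg_AE AE_I2 mult_nonneg_nonneg)
    fix u :: 'a assume "u \<in> space sphere_measure"
    then show "0 \<le> \<psi> (X u) - \<psi> m - s * (X u - m)" "0 \<le> w u"
      using s[of "X u"] X(2)[of u] w(2)[of u] by auto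
  qed
  then show ?thesis by (simp add: sphere_jensen_gap)
qed

lemma sphere_jensen_eq_iff:
  assumes sc: "strictly_convex_on {0<..} \<psi>"
  shows "(LINT u|sphere_measure. \<psi> (X u) * w u) = integral\<^sup>L sphere_measure w * \<psi> m \<longleftrightarrow>
    (\<exists>c. \<forall>u\<in>sphere 0 1. X u = c)"
proof
  assume eq: "(LINT u|sphere_measure. \<psi> (X u) * w u) = integral\<^sup>L sphere_measure w * \<psi> m"
  obtain s where s: "\<And>y. y \<in> {0<..} \<Longrightarrow> \<psi> m + s * (y - m) \<le> \<psi> y"
    using convex_supporting_line[OF strictly_convex_on_imp_convex_on[OF sc], of m] weighted_sphere_mean_pos m by auto
  let ?g = "\<lambda>u. (\<psi> (X u) - \<psi> m - s * (X u - m)) * w u"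
  have "X u = m" if u: "u \<in> sphere 0 1" for u
  proof -
    have "?g u = 0"
    proof (rule integral_sphere_eq_0_imp[of ?g, OF _ _ _ u])
      show "continuous_on (sphere 0 1) ?g"
        by (intro continuous_intros continuous_on_sphere_comp X w)
      show "0 \<le> ?g v" if "v \<in> sphere 0 1" for v
        using s[of "X v"] X(2)[OF that] w(2)[OF that] by (intro mult_nonneg_nonneg) auto
      show "integral\<^sup>L sphere_measure ?g = 0"
        using eq by (simp add: sphere_jensen_gap)
    qed
    with w(2)[OF u] have touch: "\<psi> (X u) = \<psi> m + s * (X u - m)" by simp
    have "m \<in> {0<..}" "X u \<in> {0<..}"
      using X(2)[OF u] weighted_sphere_mean_pos m by auto
    then show ?thesis
      using s touch by (rule strictly_convex_supporting_line[OF sc])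
  qed
  then show "\<exists>c. \<forall>u\<in>sphere 0 1. X u = c" by blast
next
  assume "\<exists>c. \<forall>u\<in>sphere 0 1. X u = c"
  then obtain c where c: "\<And>u. u \<in> sphere 0 1 \<Longrightarrow> X u = c" by blast
  moreover from c have "m = c" unfolding m by (rule weighted_sphere_mean_const)
  ultimately have "(LINT u|sphere_measure. \<psi> (X u) * w u) = (LINT u|sphere_measure. \<psi> m * w u)"
    by (intro Bochner_Integration.integral_cong) simp_all
  then show "(LINT u|sphere_measure. \<psi> (X u) * w u) = integral\<^sup>L sphere_measure w * \<psi> m" by simp
qed

end

end

section \<open>Star bodies and their radial functions\<close>

text \<open>Compactness makes the supremum in the radial function attained, and star-shapedness fills the
  segment below it.\<close>
lemma star_body_mem_iff:
  fixes L :: "'a::euclidean_space set"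
  assumes L: "star_body L" and u: "u \<in> sphere 0 1" and t: "0 \<le> t"
  shows "t *\<^sub>R u \<in> L \<longleftrightarrow> t \<le> radial_function L u"
proof -
  let ?R = "insert 0 {r. 0 < r \<and> r *\<^sub>R u \<in> L}"
  have R: "?R = {0..} \<inter> (\<lambda>r. r *\<^sub>R u) -` L"
    using L by (auto simp: star_body_def)
  have "compact L" using L by (simp add: star_body_def)
  then obtain b where b: "\<And>x. x \<in> L \<Longrightarrow> norm x \<le> b"
    using compact_imp_bounded bounded_iff by metis
  have "r \<le> max b 0" if "r \<in> ?R" for r
    using that b[of "r *\<^sub>R u"] u by auto
  then have bdd: "bdd_above ?R" by (rule bdd_aboveI)
  have "closed ?R"
    unfolding R using \<open>compact L\<close> compact_imp_closed
    by (intro closed_Int closed_vimage continuous_intros) auto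
  then have attained: "radial_function L u \<in> ?R"
    unfolding radial_function_def using bdd by (intro closed_contains_Sup) auto
  show ?thesis
  proof
    assume "t *\<^sub>R u \<in> L"
    then have "t \<in> ?R" using t by auto
    then show "t \<le> radial_function L u"
      unfolding radial_function_def using bdd by (intro cSup_upper) auto
  next
    assume le: "t \<le> radial_function L u"
    have pos: "0 < radial_function L u" using L u by (simp add: star_body_def)
    with attained have "radial_function L u *\<^sub>R u \<in> L" by auto
    then have "closed_segment 0 (radial_function L u *\<^sub>R u) \<subseteq> L"
      using L by (simp add: star_body_def)
    moreover have "t *\<^sub>R u \<in> closed_segment 0 (radial_function L u *\<^sub>R u)"
      unfolding in_segment using le t pos
      by (intro exI[of _ "t / radial_function L u"]) auto
    ultimately show "t *\<^sub>R u \<in> L" by blast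
  qed
qed

lemma dilatates_iff_radial_function:
  fixes K L :: "'a::euclidean_space set"
  assumes K: "star_body K" and L: "star_body L"
  shows "dilatates K L \<longleftrightarrow> (\<exists>c>0. \<forall>u\<in>sphere 0 1. radial_function K u = c * radial_function L u)"
proof
  assume "dilatates K L"
  then obtain c where c: "c > 0" "K = (\<lambda>x. c *\<^sub>R x) ` L" by (auto simp: dilatates_def)
  have mem: "x \<in> K \<longleftrightarrow> (1 / c) *\<^sub>R x \<in> L" for x
    using c(1) unfolding c(2) by (auto intro!: image_eqI[of _ _ "(1 / c) *\<^sub>R x"])
  have "radial_function K u = c * radial_function L u" if u: "u \<in> sphere 0 1" for u
  proof -
    have pos: "0 < radial_function K u" "0 < radial_function L u"
      using K L u by (simp_all add: star_body_def)
    have iff: "t \<le> radial_function K u \<longleftrightarrow> t \<le> c * radial_function L u" if "t \<ge> 0" for t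
    proof -
      have "t \<le> radial_function K u \<longleftrightarrow> (t / c) *\<^sub>R u \<in> L"
        using star_body_mem_iff[OF K u that] mem[of "t *\<^sub>R u"] by simp
      also have "\<dots> \<longleftrightarrow> t / c \<le> radial_function L u"
        using c(1) that by (intro star_body_mem_iff[OF L u]) simp
      finally show ?thesis using c(1) by (simp add: field_simps)
    qed
    show ?thesis
      using iff[of "radial_function K u"] iff[of "c * radial_function L u"] pos c(1) by simp
  qed
  with c(1) show "\<exists>c>0. \<forall>u\<in>sphere 0 1. radial_function K u = c * radial_function L u" by blast
next
  assume "\<exists>c>0. \<forall>u\<in>sphere 0 1. radial_function K u = c * radial_function L u"
  then obtain c where c: "c > 0" "\<And>u. u \<in> sphere 0 1 \<Longrightarrow> radial_function K u = c * radial_function L u"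
    by blast
  have mem: "x \<in> K \<longleftrightarrow> (1 / c) *\<^sub>R x \<in> L" for x
  proof (cases "x = 0")
    case True
    then show ?thesis using K L by (simp add: star_body_def)
  next
    case False
    define u where "u = (1 / norm x) *\<^sub>R x"
    have u: "u \<in> sphere 0 1" "x = norm x *\<^sub>R u" using False by (simp_all add: u_def)
    have "x \<in> K \<longleftrightarrow> norm x \<le> radial_function K u"
      using star_body_mem_iff[OF K u(1), of "norm x"] u(2) by simp
    also have "\<dots> \<longleftrightarrow> norm x / c \<le> radial_function L u"
      using c(1) c(2)[OF u(1)] by (simp add: field_simps)
    also have "\<dots> \<longleftrightarrow> (norm x / c) *\<^sub>R u \<in> L"
      using c(1) by (intro star_body_mem_iff[OF L u(1), symmetric]) simp
    also have "(norm x / c) *\<^sub>R u = (1 / c) *\<^sub>R x"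
      using False by (simp add: u_def)
    finally show ?thesis .
  qed
  have "K = (\<lambda>x. c *\<^sub>R x) ` L"
  proof (intro set_eqI iffI)
    fix x assume "x \<in> K"
    with mem c(1) show "x \<in> (\<lambda>x. c *\<^sub>R x) ` L" by (intro image_eqI[of _ _ "(1 / c) *\<^sub>R x"]) auto
  next
    fix x assume "x \<in> (\<lambda>x. c *\<^sub>R x) ` L"
    then obtain y where "y \<in> L" "x = c *\<^sub>R y" by blast
    with mem[of x] c(1) show "x \<in> K" by simp
  qed
  with c(1) show "dilatates K L" by (auto simp: dilatates_def)
qed

section \<open>The dual Orlicz--Minkowski inequality\<close>

theorem theorem8p1:
  fixes K L Q :: "(real ^ 'n) set" and q :: real and \<phi> \<phi>q :: "real \<Rightarrow> real"
  assumes "star_body K" and "star_body L" and "star_body Q"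
    and "q \<noteq> 0"
    and "continuous_on {0<..} \<phi>" and "\<And>t. t > 0 \<Longrightarrow> \<phi> t > 0"
    and "\<And>t. t > 0 \<Longrightarrow> \<phi>q t = \<phi> (t powr (1 / q))"
  shows
    "(convex_on {0<..} \<phi>q \<longrightarrow>
        orlicz_dual_mixed_volume q \<phi> K L Q \<ge>
          dual_mixed_volume q K Q *
            \<phi> ((dual_mixed_volume q L Q / dual_mixed_volume q K Q) powr (1 / q))) \<and>
     (concave_on {0<..} \<phi>q \<longrightarrow>
        orlicz_dual_mixed_volume q \<phi> K L Q \<le>
          dual_mixed_volume q K Q *
            \<phi> ((dual_mixed_volume q L Q / dual_mixed_volume q K Q) powr (1 / q))) \<and>
     (strictly_convex_on {0<..} \<phi>q \<or> strictly_concave_on {0<..} \<phi>q \<longrightarrow>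
        (orlicz_dual_mixed_volume q \<phi> K L Q =
          dual_mixed_volume q K Q *
            \<phi> ((dual_mixed_volume q L Q / dual_mixed_volume q K Q) powr (1 / q))
         \<longleftrightarrow> dilatates K L))"
proof -
  let ?n = "real DIM(real ^ 'n)"
  let ?S = "sphere (0 :: real ^ 'n) 1"
  define w where "w = (\<lambda>u. radial_function K u powr q * radial_function Q u powr (?n - q))"
  define X where "X = (\<lambda>u. (radial_function L u / radial_function K u) powr q)"
  define m where "m = weighted_sphere_mean w X"
  note star = assms(1-3)[unfolded star_body_def]
  have pos: "0 < radial_function K u" "0 < radial_function L u" "0 < radial_function Q u" if "u \<in> ?S" for u
    using star that by auto
  have ne: "radial_function K u \<noteq> 0" "radial_function L u \<noteq> 0" "radial_function Q u \<noteq> 0" if "u \<in> ?S" for u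
    using pos[OF that] by auto
  have n: "?n > 0" by simp
  have w: "continuous_on ?S w" "\<And>u. u \<in> ?S \<Longrightarrow> 0 < w u"
    unfolding w_def
    subgoal using star ne by (intro continuous_intros) auto
    subgoal for u using ne[of u] by (intro mult_pos_pos) auto
    done
  have X: "continuous_on ?S X" "\<And>u. u \<in> ?S \<Longrightarrow> 0 < X u"
    unfolding X_def
    subgoal using star ne by (intro continuous_intros) auto
    subgoal for u using ne[of u] by auto
    done
  have "continuous_on {0<..} (\<lambda>t. \<phi> (t powr (1 / q)))"
    by (rule continuous_on_compose2[OF assms(5)]) (auto intro: continuous_on_powr continuous_on_id continuous_on_const)
  then have cont: "continuous_on {0<..} \<phi>q"
    using assms(7) by (subst continuous_on_cong[OF refl]) auto
  have cont': "continuous_on {0<..} (\<lambda>t. - \<phi>q t)" by (intro continuous_intros cont)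
  have volK: "dual_mixed_volume q K Q = integral\<^sup>L sphere_measure w / ?n"
    unfolding dual_mixed_volume_def set_integral_sphere_eq w_def by simp
  have volL: "dual_mixed_volume q L Q = (LINT u|sphere_measure. X u * w u) / ?n"
  proof -
    have "(LINT u|sphere_measure. radial_function L u powr q * radial_function Q u powr (?n - q))
        = (LINT u|sphere_measure. X u * w u)"
      using pos by (intro Bochner_Integration.integral_cong)
        (simp_all add: X_def w_def powr_divide less_imp_le ne)
    then show ?thesis
      unfolding dual_mixed_volume_def set_integral_sphere_eq by simp
  qed
  have orlicz: "orlicz_dual_mixed_volume q \<phi> K L Q = (LINT u|sphere_measure. \<phi>q (X u) * w u) / ?n"
  proof -
    have "\<phi> (radial_function L u / radial_function K u) = \<phi>q (X u)" if "u \<in> ?S" for u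
      using pos[OF that] assms(4) assms(7)[OF X(2)[OF that]] by (simp add: X_def powr_powr)
    then have "(LINT u|sphere_measure. \<phi> (radial_function L u / radial_function K u) *
        radial_function K u powr q * radial_function Q u powr (?n - q)) = (LINT u|sphere_measure. \<phi>q (X u) * w u)"
      by (intro Bochner_Integration.integral_cong) (simp_all add: w_def)
    then show ?thesis
      unfolding orlicz_dual_mixed_volume_def set_integral_sphere_eq by simp
  qed
  have m_pos: "0 < m"
    unfolding m_def by (rule weighted_sphere_mean_pos[OF w X])
  have "dual_mixed_volume q L Q / dual_mixed_volume q K Q = m"
    unfolding volK volL m_def weighted_sphere_mean_def by simp
  then have rhs: "dual_mixed_volume q K Q *
      \<phi> ((dual_mixed_volume q L Q / dual_mixed_volume q K Q) powr (1 / q))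
      = (integral\<^sup>L sphere_measure w * \<phi>q m) / ?n"
    using assms(7)[OF m_pos] volK by simp
  \<comment> \<open>The exponent \<open>q\<close> is invertible as \<open>q \<noteq> 0\<close>, so \<open>X\<close> determines \<open>\<rho>\<^sub>L / \<rho>\<^sub>K\<close>.\<close>
  have dil: "dilatates K L \<longleftrightarrow> (\<exists>c. \<forall>u\<in>?S. X u = c)"
  proof -
    have "(\<exists>c>0. \<forall>u\<in>?S. radial_function K u = c * radial_function L u) \<longleftrightarrow> (\<exists>c. \<forall>u\<in>?S. X u = c)"
    proof safe
      fix c :: real assume c: "c > 0" "\<forall>u\<in>?S. radial_function K u = c * radial_function L u"
      have "X u = (1 / c) powr q" if "u \<in> ?S" for u
        using c(1) bspec[OF c(2) that] pos[OF that] by (simp add: X_def)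
      then show "\<exists>c. \<forall>u\<in>?S. X u = c" by blast
    next
      fix c assume c: "\<forall>u\<in>?S. X u = c"
      obtain u0 where "u0 \<in> ?S" using vector_choose_size[of 1] by auto
      with X(2) c have "c > 0" by force
      have "radial_function K u = (1 / c powr (1 / q)) * radial_function L u" if "u \<in> ?S" for u
      proof -
        have "c powr (1 / q) = radial_function L u / radial_function K u"
          using bspec[OF c that, symmetric] pos[OF that] assms(4) by (simp add: X_def powr_powr)
        then show ?thesis using pos[OF that] by simp
      qed
      with \<open>c > 0\<close> show "\<exists>c>0. \<forall>u\<in>?S. radial_function K u = c * radial_function L u"
        by (intro exI[of _ "1 / c powr (1 / q)"]) auto
    qed
    then show ?thesis by (simp add: dilatates_iff_radial_function assms)
  qed
  have cancel: "a / ?n \<le> b / ?n \<longleftrightarrow> a \<le> b" "a / ?n = b / ?n \<longleftrightarrow> a = b" for a b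
    using n by (auto simp: divide_le_cancel)
  \<comment> \<open>Rewrites the convex results for \<open>- \<phi>q\<close> into statements about \<open>\<phi>q\<close>.\<close>
  have concave_rhs: "integral\<^sup>L sphere_measure w * - \<phi>q m = - (integral\<^sup>L sphere_measure w * \<phi>q m)"
    "(LINT u|sphere_measure. - \<phi>q (X u) * w u) = - (LINT u|sphere_measure. \<phi>q (X u) * w u)"
    by simp_all
  show ?thesis
    unfolding rhs orlicz dil cancel
  proof (intro conjI impI)
    assume convex: "convex_on {0<..} \<phi>q"
    show "integral\<^sup>L sphere_measure w * \<phi>q m \<le> (LINT u|sphere_measure. \<phi>q (X u) * w u)"
      by (rule sphere_jensen[OF w X cont m_def convex])
  next
    assume "concave_on {0<..} \<phi>q"
    then have convex: "convex_on {0<..} (\<lambda>t. - \<phi>q t)" by (simp add: concave_on_def)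
    show "(LINT u|sphere_measure. \<phi>q (X u) * w u) \<le> integral\<^sup>L sphere_measure w * \<phi>q m"
      using sphere_jensen[OF w X cont' m_def convex] unfolding concave_rhs by simp
  next
    assume "strictly_convex_on {0<..} \<phi>q \<or> strictly_concave_on {0<..} \<phi>q"
    then consider "strictly_convex_on {0<..} \<phi>q" | "strictly_convex_on {0<..} (\<lambda>t. - \<phi>q t)"
      by (auto simp: strictly_concave_on_def)
    then show "((LINT u|sphere_measure. \<phi>q (X u) * w u) = integral\<^sup>L sphere_measure w * \<phi>q m) \<longleftrightarrow>
        (\<exists>c. \<forall>u\<in>?S. X u = c)"
    proof cases
      case 1
      show ?thesis by (rule sphere_jensen_eq_iff[OF w X cont m_def 1])
    next
      case 2
      show ?thesis
        using sphere_jensen_eq_iff[OF w X cont' m_def 2] unfolding concave_rhs neg_equal_iff_equal .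
    qed
  qed
qed

end
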